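(* Let $X_t^x$ be a Feller process on $\mathbb{R}$ generated by $$Lg(x)=a(x)g''(x)+b(x)g'(x)+\int_{-\infty}^{\infty}\bigl(g(z)-g(x)-(z-x)g'(x)\mathbf{1}_{|z-x|\le1}\bigr)\nu(x,dz),$$ where $a,b\in C^2(\mathbb{R})$, $a\ge0$, and $\nu$ is a weakly continuous Lévy kernel such that, for any $y$: $\lim_{z\to-\infty}\int_{w\ge y}\nu(z,dw)=0$ and $\lim_{z\to\infty}\int_{w<y}\nu(z,dw)=0$; the functions $\int_{w\ge y}\nu(z,dw)$ and $-\int_{w<y}\nu(z,dw)$ are non-decreasing in $z$ for $z<y$ and $z>y$ respectively; $\mathbf{1}_{z<y}d_z\int_{w\ge y}\nu(z,dw)-\mathbf{1}_{z>y}d_z\int_{w<y}\nu(z,dw)$ is a Lévy kernel (it integrates $\min(1,(z-y)^2)$); and the integral $$\int_{y-1}^{y+1}(z-y)\Bigl[\mathbf{1}_{z<y}\bigl(\nu(y,dz)+d_z\int_{w\ge y}\nu(z,dw)\bigr)+\mathbf{1}_{z>y}\bigl(\nu(y,dz)-d_z\int_{w<y}\nu(z,dw)\bigr)\Bigr]$$ exists at least in the sense of the Cauchy principal value. Assume additionally that $a$ is even, $b$ is odd, the support of $\nu(x,\cdot)$ is in $\mathbb{R}_+$ for $x\ge0$, $\nu(-x,dy)=R\nu(x,dy)$, and that the measure $\nu(0,dw)$ is bounded. Let $Y_t^y$ be the process on $\bar{\mathbb{R}}_+$ dual to the reflected process $|X_t^x|$. Then the initial reflected process $|X_t^x|$ is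 a regularized dual to $Y_t^y$. Thus the second regularized dual to $|X_t^x|$ coincides with $|X_t^x|$.
   Context: $\bar{\mathbb{R}}_+=\{x\ge0\}$. $C^2(\mathbb{R})$ is the space of bounded continuous functions with bounded continuous derivatives up to order two. A Lévy kernel $\nu(x,dz)$ is a family of positive measures on $\mathbb{R}\setminus\{x\}$ with $\int\min(1,(z-x)^2)\nu(x,dz)<\infty$. $R$ denotes reflection of a measure with respect to the origin: $\int\phi(y)R\nu(x,dy)=\int\phi(-y)\nu(x,dy)$. $d_z$ denotes the Stieltjes differential in $z$. Superscripts denote initial points. Under the symmetry assumptions, $|X_t^x|$, $x\ge0$, is a Markov process on $\bar{\mathbb{R}}_+$ ($X_t^x$ reflected at the origin). The dual $Y_t^y$ on $\bar{\mathbb{R}}_+$ to $|X_t^x|$ satisfies $\mathbf{P}(|X_t^x|\ge y)=\mathbf{P}(Y_t^y\le x)$ for all $x,y\ge0$, $t\ge0$ (under the stated assumptions it exists and is a Feller process absorbed at the origin). Regularized dual: let $Z_t^x$ be a stochastically monotone process on $[c,\infty)$ (that is, $\mathbf{P}(Z_t^x\ge y)$ is monotone in $x$ for every $y$) such that $\mathbf{P}(Z_t^x\ge y)$ is right continuous in $x$. A process $W_t^y$ on $[c,\infty)$ is called a regularized dual to $Z_t^x$ if $\mathbf{P}(Z_t^x\ge y)=\mathbf{P}(W_t^y\le x)$ holds for all $x\ge c$, $y>c$, and the distribution for $y=c$ is defined by continuity as $\mathbf{P}(W_t^c\le x)=\lim_{y\to c,\,y>c}\mathbf{P}(W_t^y\le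 x)$. Here $c=0$. The second regularized dual is the regularized dual of the (regularized) dual.
   Formalization: In "regularized dual", the limit defining the distribution at y=c is required only at continuity points x of the limiting distribution function, since at all x it fails (constant process, x=c); the dual Y is taken to be a given Feller process, as in the setting. *)

theory Defs
  imports "HOL-Probability.Probability"
begin

section \<open>Function spaces on the line\<close>

definition C2 :: "(real \<Rightarrow> real) set" where
  "C2 = {f. f differentiable_on UNIV \<and> deriv f differentiable_on UNIV
          \<and> continuous_on UNIV (deriv (deriv f))
          \<and> bounded (range f) \<and> bounded (range (deriv f)) \<and> bounded (range (deriv (deriv f)))}"

text \<open>Continuous functions on \<open>E\<close> vanishing at infinity; values outside \<open>E\<close> are irrelevant.\<close>

definition C_inf :: "real set \<Rightarrow> (real \<Rightarrow> real) set" where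
  "C_inf E = {f. continuous_on E f \<and> (f \<longlongrightarrow> 0) (inf at_infinity (principal E))}"


section \<open>Processes indexed by their initial point\<close>

text \<open>
  A process is a pair \<open>M\<close>, \<open>X\<close>: for the initial point \<open>x\<close>, \<open>M x\<close> is the probability space
  and \<open>X x t\<close> is the random variable written $X_t^x$ on paper. Times are reals \<open>t \<ge> 0\<close>.
\<close>

definition process_on ::
  "real set \<Rightarrow> (real \<Rightarrow> 'w measure) \<Rightarrow> (real \<Rightarrow> real \<Rightarrow> 'w \<Rightarrow> real) \<Rightarrow> bool" where
  "process_on E M X \<longleftrightarrow> (\<forall>x\<in>E. prob_space (M x)
     \<and> (\<forall>t\<ge>0. X x t \<in> M x \<rightarrow>\<^sub>M restrict_space borel E)
     \<and> (AE \<omega> in M x. X x 0 \<omega> = x))"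

definition law ::
  "(real \<Rightarrow> 'w measure) \<Rightarrow> (real \<Rightarrow> real \<Rightarrow> 'w \<Rightarrow> real) \<Rightarrow> real \<Rightarrow> real \<Rightarrow> real measure" where
  "law M X t x = distr (M x) borel (X x t)"

definition past ::
  "(real \<Rightarrow> 'w measure) \<Rightarrow> (real \<Rightarrow> real \<Rightarrow> 'w \<Rightarrow> real) \<Rightarrow> real \<Rightarrow> real \<Rightarrow> 'w measure" where
  "past M X x s =
     sigma (space (M x)) {X x u -` B \<inter> space (M x) | u B. 0 \<le> u \<and> u \<le> s \<and> B \<in> sets borel}"

definition markov_process ::
  "real set \<Rightarrow> (real \<Rightarrow> 'w measure) \<Rightarrow> (real \<Rightarrow> real \<Rightarrow> 'w \<Rightarrow> real) \<Rightarrow> bool" where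
  "markov_process E M X \<longleftrightarrow> process_on E M X
     \<and> (\<forall>t\<ge>0. \<forall>B\<in>sets borel. (\<lambda>x. measure (law M X t x) B) \<in> borel_measurable (restrict_space borel E))
     \<and> (\<forall>x\<in>E. \<forall>s\<ge>0. \<forall>t\<ge>0. \<forall>B\<in>sets borel.
          AE \<omega> in M x. real_cond_exp (M x) (past M X x s) (\<lambda>\<omega>. indicator B (X x (s + t) \<omega>)) \<omega>
                        = measure (law M X t (X x s \<omega>)) B)"

definition semigroup_of ::
  "(real \<Rightarrow> 'w measure) \<Rightarrow> (real \<Rightarrow> real \<Rightarrow> 'w \<Rightarrow> real) \<Rightarrow> real \<Rightarrow> (real \<Rightarrow> real) \<Rightarrow> real \<Rightarrow> real" where
  "semigroup_of M X t f x = (LINT \<omega>|M x. f (X x t \<omega>))"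

definition feller_process ::
  "real set \<Rightarrow> (real \<Rightarrow> 'w measure) \<Rightarrow> (real \<Rightarrow> real \<Rightarrow> 'w \<Rightarrow> real) \<Rightarrow> bool" where
  "feller_process E M X \<longleftrightarrow> markov_process E M X
     \<and> (\<forall>f\<in>C_inf E. (\<forall>t\<ge>0. semigroup_of M X t f \<in> C_inf E)
                   \<and> uniform_limit E (\<lambda>t. semigroup_of M X t f) f (at_right 0))"

definition infinitesimal_generator ::
  "(real \<Rightarrow> 'w measure) \<Rightarrow> (real \<Rightarrow> real \<Rightarrow> 'w \<Rightarrow> real) \<Rightarrow> ((real \<Rightarrow> real) \<times> (real \<Rightarrow> real)) set" where
  "infinitesimal_generator M X = {(f, h). f \<in> C_inf UNIV \<and> h \<in> C_inf UNIV
     \<and> uniform_limit UNIV (\<lambda>t x. (semigroup_of M X t f x - f x) / t) h (at_right 0)}"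

text \<open>
  A process is generated by \<open>L\<close> if its infinitesimal generator on \<open>C_inf UNIV\<close> is the closure of
  \<open>L\<close> on its natural domain of classical functions \<open>g\<close>, those for which \<open>L g\<close> vanishes at infinity.
\<close>

definition generated_by ::
  "(real \<Rightarrow> 'w measure) \<Rightarrow> (real \<Rightarrow> real \<Rightarrow> 'w \<Rightarrow> real) \<Rightarrow> ((real \<Rightarrow> real) \<Rightarrow> real \<Rightarrow> real) \<Rightarrow> bool" where
  "generated_by M X L \<longleftrightarrow> (\<forall>f h. (f, h) \<in> infinitesimal_generator M X \<longleftrightarrow>
     (\<exists>g :: nat \<Rightarrow> real \<Rightarrow> real. (\<forall>n. g n \<in> C2 \<inter> C_inf UNIV \<and> L (g n) \<in> C_inf UNIV)
        \<and> uniform_limit UNIV g f sequentially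
        \<and> uniform_limit UNIV (\<lambda>n. L (g n)) h sequentially))"


section \<open>L\'evy kernels\<close>

definition levy_kernel :: "(real \<Rightarrow> real measure) \<Rightarrow> bool" where
  "levy_kernel \<nu> \<longleftrightarrow> (\<forall>x. sets (\<nu> x) = sets borel \<and> emeasure (\<nu> x) {x} = 0
     \<and> (\<integral>\<^sup>+z. ennreal (min 1 ((z - x)\<^sup>2)) \<partial>\<nu> x) < \<infinity>)"

text \<open>
  A L\'evy measure may be infinite near \<open>x\<close>, so weak continuity is that of the associated finite
  measures with density \<open>min 1 ((z - x)\<^sup>2)\<close>.
\<close>

definition weakly_continuous_kernel :: "(real \<Rightarrow> real measure) \<Rightarrow> bool" where
  "weakly_continuous_kernel \<nu> \<longleftrightarrow>
     (\<forall>f :: real \<Rightarrow> real. continuous_on UNIV f \<and> bounded (range f) \<longrightarrow>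
        continuous_on UNIV (\<lambda>x. LINT z|\<nu> x. f z * min 1 ((z - x)\<^sup>2)))"

definition levy_operator ::
  "(real \<Rightarrow> real) \<Rightarrow> (real \<Rightarrow> real) \<Rightarrow> (real \<Rightarrow> real measure) \<Rightarrow> (real \<Rightarrow> real) \<Rightarrow> real \<Rightarrow> real" where
  "levy_operator a b \<nu> g x = a x * deriv (deriv g) x + b x * deriv g x
     + (LINT z|\<nu> x. g z - g x - (z - x) * deriv g x * indicator {z. \<bar>z - x\<bar> \<le> 1} z)"

text \<open>
  Stieltjes measure of a nondecreasing right-continuous \<open>F\<close> on an open interval \<open>S\<close>. The library's
  \<open>interval_measure\<close> does not apply, because \<open>F\<close> may be unbounded at the ends of \<open>S\<close>.
\<close>

definition stieltjes_measure :: "real set \<Rightarrow> (real \<Rightarrow> real) \<Rightarrow> real measure" where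
  "stieltjes_measure S F = extend_measure S {(c, d). c \<in> S \<and> d \<in> S \<and> c \<le> d}
     (\<lambda>(c, d). {c<..d}) (\<lambda>(c, d). ennreal (F d - F c))"

text \<open>
  The measure $1_{z<y}\,d_z\int_{w\ge y}\nu(z,dw)-1_{z>y}\,d_z\int_{w<y}\nu(z,dw)$. For a L\'evy
  kernel both inner integrals are finite on the half-line where they are used, and under the
  monotonicity assumptions both contributions are nonnegative. If the kernel is in addition weakly
  continuous, the two integrands are right-continuous in \<open>z\<close>.
\<close>

definition dual_kernel :: "(real \<Rightarrow> real measure) \<Rightarrow> real \<Rightarrow> real measure" where
  "dual_kernel \<nu> y = measure_of UNIV (sets borel) (\<lambda>A.
       emeasure (stieltjes_measure {..<y} (\<lambda>z. measure (\<nu> z) {y..})) (A \<inter> {..<y})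
     + emeasure (stieltjes_measure {y<..} (\<lambda>z. - measure (\<nu> z) {..<y})) (A \<inter> {y<..}))"

text \<open>Existence of $\int_{y-1}^{y+1}(z-y)(\nu+\nu')(y,dz)$ as a Cauchy principal value at \<open>y\<close>.\<close>

definition pv_integral_exists ::
  "(real \<Rightarrow> real measure) \<Rightarrow> (real \<Rightarrow> real measure) \<Rightarrow> real \<Rightarrow> bool" where
  "pv_integral_exists \<nu> \<nu>' y \<longleftrightarrow> (\<exists>l. ((\<lambda>\<epsilon>.
       (LINT z:{z. \<epsilon> < \<bar>z - y\<bar> \<and> \<bar>z - y\<bar> \<le> 1}|\<nu> y. z - y)
     + (LINT z:{z. \<epsilon> < \<bar>z - y\<bar> \<and> \<bar>z - y\<bar> \<le> 1}|\<nu>' y. z - y)) \<longlongrightarrow> l) (at_right 0))"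


section \<open>Duality\<close>

definition reflected :: "(real \<Rightarrow> real \<Rightarrow> 'w \<Rightarrow> real) \<Rightarrow> real \<Rightarrow> real \<Rightarrow> 'w \<Rightarrow> real" where
  "reflected X x t \<omega> = \<bar>X x t \<omega>\<bar>"

definition dual_on ::
  "real set \<Rightarrow> (real \<Rightarrow> 'w measure) \<Rightarrow> (real \<Rightarrow> real \<Rightarrow> 'w \<Rightarrow> real)
    \<Rightarrow> (real \<Rightarrow> 'v measure) \<Rightarrow> (real \<Rightarrow> real \<Rightarrow> 'v \<Rightarrow> real) \<Rightarrow> bool" where
  "dual_on E M Z N Y \<longleftrightarrow> (\<forall>t\<ge>0. \<forall>x\<in>E. \<forall>y\<in>E.
     \<P>(\<omega> in M x. Z x t \<omega> \<ge> y) = \<P>(\<omega> in N y. Y y t \<omega> \<le> x))"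

definition stochastically_monotone ::
  "real \<Rightarrow> (real \<Rightarrow> 'w measure) \<Rightarrow> (real \<Rightarrow> real \<Rightarrow> 'w \<Rightarrow> real) \<Rightarrow> bool" where
  "stochastically_monotone c M Z \<longleftrightarrow>
     (\<forall>t\<ge>0. \<forall>y. mono_on {c..} (\<lambda>x. \<P>(\<omega> in M x. Z x t \<omega> \<ge> y)))"

text \<open>
  \<open>regularized_dual c M Z N W\<close>: the process \<open>(N, W)\<close> is a regularized dual to \<open>(M, Z)\<close> on
  \<open>[c, \<infinity>)\<close>. The distribution of \<open>W\<close> started at \<open>c\<close> is the limit of those of \<open>W\<close>
  started at \<open>y \<down> c\<close> in the sense of convergence of distribution functions: as in the library's
  \<open>weak_conv\<close>, convergence is at the continuity points of the limit. Pointwise convergence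
  everywhere would be too much, since the pointwise limit need not be a distribution function: for
  \<open>W\<close> started at \<open>y\<close> and constant in time, it vanishes at \<open>c\<close> and equals 1 to the right of \<open>c\<close>.
\<close>

definition regularized_dual ::
  "real \<Rightarrow> (real \<Rightarrow> 'w measure) \<Rightarrow> (real \<Rightarrow> real \<Rightarrow> 'w \<Rightarrow> real)
    \<Rightarrow> (real \<Rightarrow> 'v measure) \<Rightarrow> (real \<Rightarrow> real \<Rightarrow> 'v \<Rightarrow> real) \<Rightarrow> bool" where
  "regularized_dual c M Z N W \<longleftrightarrow>
     process_on {c..} M Z \<and> process_on {c..} N W
     \<and> stochastically_monotone c M Z
     \<and> (\<forall>t\<ge>0. \<forall>y. \<forall>x\<ge>c. continuous (at_right x) (\<lambda>x. \<P>(\<omega> in M x. Z x t \<omega> \<ge> y)))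
     \<and> (\<forall>t\<ge>0. \<forall>x\<ge>c. \<forall>y>c. \<P>(\<omega> in M x. Z x t \<omega> \<ge> y) = \<P>(\<omega> in N y. W y t \<omega> \<le> x))
     \<and> (\<forall>t\<ge>0. \<forall>x. isCont (cdf (law N W t c)) x \<longrightarrow>
          ((\<lambda>y. \<P>(\<omega> in N y. W y t \<omega> \<le> x)) \<longlongrightarrow> \<P>(\<omega> in N c. W c t \<omega> \<le> x)) (at_right c))"

end

theory Submission
  imports Defs
begin

text \<open>
  By the Feller property of both processes, the probabilities of \<open>{..r}\<close> under the laws of
  $|X_t^x|$ and $Y_t^y$ are upper semicontinuous in the initial point, and those of \<open>{..<r}\<close> are
  lower semicontinuous. Moving the initial point of $X$ to its limit from below, or that of $Y$
  from above, in the duality relation therefore gives the two inequalities in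
  $P(Y_t^x \ge y) = P(|X_t^y| \le x)$ for \<open>y > 0\<close>, which makes $|X_t|$ a regularized dual of $Y$.
  A regularized dual is determined in law by the laws of the original process, because
  distribution functions that agree at common continuity points are equal.
\<close>

section \<open>Piecewise linear cutoffs and half-line masses of a single distribution\<close>

text \<open>For \<open>c < d\<close>, a continuous function squeezed between the indicators of
  \<open>{..c}\<close> and \<open>{..<d}\<close>. It vanishes for large arguments, so on a half-line
  bounded below it is a test function for the Feller property.\<close>

definition ramp :: "real \<Rightarrow> real \<Rightarrow> real \<Rightarrow> real" where
  "ramp c d z = max 0 (min 1 ((d - z) / (d - c)))"

lemma continuous_on_ramp: "c < d \<Longrightarrow> continuous_on A (ramp c d)"
  unfolding ramp_def by (intro continuous_intros) auto

lemma ramp_measurable [measurable]: "ramp c d \<in> borel_measurable borel"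
  unfolding ramp_def by measurable

lemma ramp_nonneg: "0 \<le> ramp c d z" and ramp_le_1: "ramp c d z \<le> 1"
  by (auto simp: ramp_def)

lemma ramp_eq_1: "c < d \<Longrightarrow> z \<le> c \<Longrightarrow> ramp c d z = 1"
  by (auto simp: ramp_def min_def max_def field_simps)

lemma ramp_eq_0: "c < d \<Longrightarrow> d \<le> z \<Longrightarrow> ramp c d z = 0"
  by (auto simp: ramp_def min_def max_def field_simps)

text \<open>Testing against ramps only is enough for one-sided control of half-line masses.\<close>

definition vaguely_continuous :: "real set \<Rightarrow> (real \<Rightarrow> real measure) \<Rightarrow> bool" where
  "vaguely_continuous S \<mu> \<longleftrightarrow> (\<forall>x\<in>S. real_distribution (\<mu> x))
     \<and> (\<forall>c d. c < d \<longrightarrow> continuous_on S (\<lambda>x. LINT z|\<mu> x. ramp c d z))"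

context real_distribution
begin

lemma integrable_ramp: "integrable M (ramp c d)"
  by (rule integrable_const_bound[where B=1]) (auto simp: ramp_nonneg ramp_le_1)

lemma measure_le_integral_ramp:
  assumes "c < d"
  shows "measure M {..c} \<le> (LINT z|M. ramp c d z)"
proof -
  have "integrable M (indicator {..c} :: real \<Rightarrow> real)"
    by (simp add: emeasure_eq_measure)
  then have "(LINT z|M. indicator {..c} z) \<le> (LINT z|M. ramp c d z)"
    by (intro integral_mono integrable_ramp)
       (auto split: split_indicator simp: ramp_eq_1 ramp_nonneg assms)
  then show ?thesis by simp
qed

lemma integral_ramp_le_measure:
  assumes "c < d"
  shows "(LINT z|M. ramp c d z) \<le> measure M {..<d}"
proof -
  have "integrable M (indicator {..<d} :: real \<Rightarrow> real)"
    by (simp add: emeasure_eq_measure)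
  then have "(LINT z|M. ramp c d z) \<le> (LINT z|M. indicator {..<d} z)"
    by (intro integral_mono integrable_ramp)
       (auto split: split_indicator simp: ramp_eq_0 ramp_le_1 assms)
  then show ?thesis by simp
qed

text \<open>The left limit of the distribution function is the mass of the open half-line. The gap
  between \<open>z\<close> and \<open>x\<close> later makes room for a ramp.\<close>

lemma measure_lessThan_approx:
  assumes "e < measure M {..<x}"
  obtains z where "z < x" "e < measure M {..z}"
proof -
  have "eventually (\<lambda>z. e < cdf M z) (at_left x)"
    using cdf_at_left[of x] assms by (rule order_tendstoD)
  then have "eventually (\<lambda>z. z < x \<and> e < cdf M z) (at_left x)"
    by (simp add: eventually_at_filter eventually_mono)
  then obtain z where "z < x" "e < cdf M z"
    using eventually_happens[of _ "at_left x"] by auto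
  then show ?thesis using that by (simp add: cdf_def)
qed

lemma measure_atMost_approx:
  assumes "measure M {..x} < e"
  obtains z where "x < z" "measure M {..z} < e"
proof -
  have "(cdf M \<longlongrightarrow> cdf M x) (at_right x)"
    using cdf_is_right_cont[of x] by (simp add: continuous_within)
  then have "eventually (\<lambda>z. cdf M z < e) (at_right x)"
    using assms by (intro order_tendstoD) (auto simp: cdf_def)
  then have "eventually (\<lambda>z. x < z \<and> cdf M z < e) (at_right x)"
    by (simp add: eventually_at_filter eventually_mono)
  then obtain z where "x < z" "cdf M z < e"
    using eventually_happens[of _ "at_right x"] by auto
  then show ?thesis using that by (simp add: cdf_def)
qed

end

section \<open>Semicontinuity of half-line masses in the initial point\<close>

lemma vaguely_continuous_tendsto:
  assumes "vaguely_continuous S \<mu>" "x \<in> S" "c < d"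
  shows "((\<lambda>x. LINT z|\<mu> x. ramp c d z) \<longlongrightarrow> (LINT z|\<mu> x. ramp c d z)) (at x within S)"
  using assms by (auto simp: vaguely_continuous_def continuous_on_def)

text \<open>Right continuity of the distribution function allows \<open>r\<close> to be enlarged to
  some \<open>s\<close> with mass still below \<open>e\<close>. The integral of
  \<open>ramp r s\<close> then lies below \<open>e\<close> at \<open>x\<close>, hence nearby, and it
  dominates the mass of \<open>{..r}\<close>.\<close>

lemma vaguely_continuous_upper:
  assumes \<mu>: "vaguely_continuous S \<mu>" and x: "x \<in> S" and e: "measure (\<mu> x) {..r} < e"
  shows "eventually (\<lambda>x'. measure (\<mu> x') {..r} < e) (at x within S)"
proof -
  interpret real_distribution "\<mu> x" using \<mu> x by (auto simp: vaguely_continuous_def)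
  obtain s where s: "r < s" "measure (\<mu> x) {..s} < e"
    using measure_atMost_approx[OF e] .
  have "measure (\<mu> x) {..<s} \<le> measure (\<mu> x) {..s}"
    by (intro finite_measure_mono) auto
  then have "(LINT z|\<mu> x. ramp r s z) < e"
    using integral_ramp_le_measure[OF s(1)] s(2) by linarith
  with vaguely_continuous_tendsto[OF \<mu> x s(1)]
  have "eventually (\<lambda>x'. (LINT z|\<mu> x'. ramp r s z) < e) (at x within S)"
    by (rule order_tendstoD)
  moreover have "eventually (\<lambda>x'. x' \<in> S) (at x within S)"
    by (simp add: eventually_at_filter)
  ultimately show ?thesis
  proof eventually_elim
    case (elim x')
    then interpret x': real_distribution "\<mu> x'" using \<mu> by (auto simp: vaguely_continuous_def)
    show ?case using x'.measure_le_integral_ramp[OF s(1)] elim by linarith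
  qed
qed

text \<open>The mirror image of the upper bound: the ramp descends from \<open>s < r\<close> to
  \<open>r\<close>, so it fits under the indicator of \<open>{..<r}\<close>.\<close>

lemma vaguely_continuous_lower:
  assumes \<mu>: "vaguely_continuous S \<mu>" and x: "x \<in> S" and e: "e < measure (\<mu> x) {..<r}"
  shows "eventually (\<lambda>x'. e < measure (\<mu> x') {..<r}) (at x within S)"
proof -
  interpret real_distribution "\<mu> x" using \<mu> x by (auto simp: vaguely_continuous_def)
  obtain s where s: "s < r" "e < measure (\<mu> x) {..s}"
    using measure_lessThan_approx[OF e] .
  have "e < (LINT z|\<mu> x. ramp s r z)"
    using measure_le_integral_ramp[OF s(1)] s(2) by linarith
  with vaguely_continuous_tendsto[OF \<mu> x s(1)]
  have "eventually (\<lambda>x'. e < (LINT z|\<mu> x'. ramp s r z)) (at x within S)"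
    by (rule order_tendstoD)
  moreover have "eventually (\<lambda>x'. x' \<in> S) (at x within S)"
    by (simp add: eventually_at_filter)
  ultimately show ?thesis
  proof eventually_elim
    case (elim x')
    then interpret x': real_distribution "\<mu> x'" using \<mu> by (auto simp: vaguely_continuous_def)
    show ?case using x'.integral_ramp_le_measure[OF s(1)] elim by linarith
  qed
qed

text \<open>At a continuity point there is no atom, so \<open>{..r}\<close> and
  \<open>{..<r}\<close> have the same mass under the limit law and the two semicontinuity bounds
  meet.\<close>

lemma vaguely_continuous_cdf_tendsto:
  assumes \<mu>: "vaguely_continuous S \<mu>" and x: "x \<in> S" and r: "isCont (cdf (\<mu> x)) r"
  shows "((\<lambda>x'. measure (\<mu> x') {..r}) \<longlongrightarrow> measure (\<mu> x) {..r}) (at x within S)"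
proof (rule order_tendstoI)
  interpret real_distribution "\<mu> x" using \<mu> x by (auto simp: vaguely_continuous_def)
  fix e assume e: "e < measure (\<mu> x) {..r}"
  have "measure (\<mu> x) {..r} = measure (\<mu> x) {..<r} + measure (\<mu> x) {r}"
    by (subst finite_measure_Union[symmetric]) (auto intro: arg_cong[where f="measure (\<mu> x)"])
  then have "measure (\<mu> x) {..r} = measure (\<mu> x) {..<r}"
    using r by (simp add: isCont_cdf)
  then have "eventually (\<lambda>x'. e < measure (\<mu> x') {..<r}) (at x within S)"
    using e by (intro vaguely_continuous_lower[OF \<mu> x]) simp
  moreover have "eventually (\<lambda>x'. x' \<in> S) (at x within S)"
    by (simp add: eventually_at_filter)
  ultimately show "eventually (\<lambda>x'. e < measure (\<mu> x') {..r}) (at x within S)"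
  proof eventually_elim
    case (elim x')
    then interpret x': real_distribution "\<mu> x'" using \<mu> by (auto simp: vaguely_continuous_def)
    have "measure (\<mu> x') {..<r} \<le> measure (\<mu> x') {..r}"
      by (intro x'.finite_measure_mono) auto
    then show ?case using elim by linarith
  qed
next
  fix e assume "measure (\<mu> x) {..r} < e"
  then show "eventually (\<lambda>x'. measure (\<mu> x') {..r} < e) (at x within S)"
    by (rule vaguely_continuous_upper[OF \<mu> x])
qed

section \<open>Exchanging the two families in the duality relation\<close>

lemma (in real_distribution) measure_atLeast: "measure M {r..} = 1 - measure M {..<r}"
  and measure_greaterThan: "measure M {r<..} = 1 - measure M {..r}"
  using prob_compl[of "{..<r}"] prob_compl[of "{..r}"]
  by (simp_all add: Compl_eq_Diff_UNIV[symmetric])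

lemma eventually_at_left_within:
  fixes c y :: real
  assumes "c < y" "eventually P (at y within {c..})"
  shows "eventually P (at_left y)"
proof -
  \<comment> \<open>As \<open>y\<close> is interior to \<open>{c..}\<close>, restricting to the
    half-line changes nothing near \<open>y\<close>, and the left side is included.\<close>
  have "at y within {c..} = at y"
    using assms(1) by (intro at_within_interior) simp
  then show ?thesis
    using assms(2) by (simp add: eventually_at_split)
qed

text \<open>After taking complements the claim compares the open half-lines \<open>{..<y}\<close>
  and \<open>{x<..}\<close>, whereas duality relates closed ones. Shifting an initial point
  slightly, which semicontinuity permits, absorbs the difference. The strict inequality
  \<open>c < y\<close> lets \<open>y\<close> be approached from the left inside the state
  space.\<close>

lemma dual_laws_swap:
  assumes \<mu>: "vaguely_continuous {c..} \<mu>" and \<kappa>: "vaguely_continuous {c..} \<kappa>"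
    and dual: "\<And>x y. c \<le> x \<Longrightarrow> c \<le> y \<Longrightarrow> measure (\<mu> x) {y..} = measure (\<kappa> y) {..x}"
    and x: "c \<le> x" and y: "c < y"
  shows "measure (\<kappa> x) {y..} = measure (\<mu> y) {..x}"
proof -
  have dist: "real_distribution (\<mu> z)" "real_distribution (\<kappa> z)" if "c \<le> z" for z
    using \<mu> \<kappa> that by (auto simp: vaguely_continuous_def)
  interpret K: real_distribution "\<kappa> x" using dist x by auto
  interpret U: real_distribution "\<mu> y" using dist y by auto
  \<comment> \<open>Move the initial point of \<open>\<kappa>\<close> to some \<open>x' > x\<close>.
    Duality at \<open>x'\<close> yields \<open>{x'..}\<close>, which lies inside
    \<open>{x<..}\<close>.\<close>
  have "measure (\<kappa> x) {..<y} \<le> measure (\<mu> y) {x<..}"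
  proof (rule dense_le)
    fix e assume "e < measure (\<kappa> x) {..<y}"
    then have "eventually (\<lambda>x'. e < measure (\<kappa> x') {..<y}) (at x within {c..})"
      using x by (intro vaguely_continuous_lower[OF \<kappa>]) auto
    then have "eventually (\<lambda>x'. e < measure (\<kappa> x') {..<y}) (at_right x)"
      by (rule filter_leD[OF at_le, rotated]) (use x in auto)
    then have "eventually (\<lambda>x'. x < x' \<and> e < measure (\<kappa> x') {..<y}) (at_right x)"
      by (simp add: eventually_at_filter eventually_mono)
    then obtain x' where x': "x < x'" "e < measure (\<kappa> x') {..<y}"
      using eventually_happens[of _ "at_right x"] by auto
    interpret K': real_distribution "\<kappa> x'" using dist x x' by auto
    note x'(2)
    also have "measure (\<kappa> x') {..<y} \<le> measure (\<kappa> x') {..y}"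
      by (intro K'.finite_measure_mono) auto
    also have "\<dots> = measure (\<mu> y) {x'..}"
      using dual x x' y by simp
    also have "\<dots> \<le> measure (\<mu> y) {x<..}"
      using x' by (intro U.finite_measure_mono) auto
    finally show "e \<le> measure (\<mu> y) {x<..}" by simp
  qed
  \<comment> \<open>Move the initial point of \<open>\<mu>\<close> to some \<open>y' < y\<close>.
    Duality at \<open>y'\<close> yields \<open>{..y'}\<close>, which lies inside
    \<open>{..<y}\<close>.\<close>
  moreover have "measure (\<mu> y) {x<..} \<le> measure (\<kappa> x) {..<y}"
  proof (rule dense_le)
    fix e assume "e < measure (\<mu> y) {x<..}"
    then have "measure (\<mu> y) {..x} < 1 - e"
      by (simp add: U.measure_greaterThan)
    then have "eventually (\<lambda>y'. measure (\<mu> y') {..x} < 1 - e) (at y within {c..})"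
      using y by (intro vaguely_continuous_upper[OF \<mu>]) auto
    then have "eventually (\<lambda>y'. measure (\<mu> y') {..x} < 1 - e) (at_left y)"
      by (rule eventually_at_left_within[OF y])
    \<comment> \<open>Keeps \<open>y'\<close> in the state space, where duality applies.\<close>
    moreover have "eventually (\<lambda>y'. y' \<in> {c<..<y}) (at_left y)"
      using y by (rule eventually_at_left_real)
    ultimately have "eventually (\<lambda>y'. c < y' \<and> y' < y \<and> measure (\<mu> y') {..x} < 1 - e) (at_left y)"
      by eventually_elim auto
    then obtain y' where y': "c < y'" "y' < y" "measure (\<mu> y') {..x} < 1 - e"
      using eventually_happens[of _ "at_left y"] by auto
    interpret U': real_distribution "\<mu> y'" using dist y' by auto
    have "e < measure (\<mu> y') {x<..}"
      using y' by (simp add: U'.measure_greaterThan)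
    also have "\<dots> \<le> measure (\<mu> y') {x..}"
      by (intro U'.finite_measure_mono) auto
    also have "\<dots> = measure (\<kappa> x) {..y'}"
      using dual x y' by simp
    also have "\<dots> \<le> measure (\<kappa> x) {..<y}"
      using y' by (intro K.finite_measure_mono) auto
    finally show "e \<le> measure (\<kappa> x) {..<y}" by simp
  qed
  ultimately show ?thesis
    by (simp add: K.measure_atLeast U.measure_greaterThan)
qed

section \<open>Identifying a distribution from its continuity points\<close>

text \<open>Atoms are countable, so common continuity points are dense. Monotonicity and right
  continuity carry the equality from them to every point.\<close>

lemma cdf_eq_if_eq_at_continuity_points:
  assumes \<mu>: "real_distribution \<mu>" and \<kappa>: "real_distribution \<kappa>"
    and eq: "\<And>x. isCont (cdf \<mu>) x \<Longrightarrow> isCont (cdf \<kappa>) x \<Longrightarrow> cdf \<mu> x = cdf \<kappa> x"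
  shows "\<mu> = \<kappa>"
proof -
  \<comment> \<open>Stated for arbitrary distributions, to be applied a second time with the roles
    exchanged.\<close>
  have le: "cdf \<mu> x \<le> cdf \<kappa> x"
    if \<mu>: "real_distribution \<mu>" and \<kappa>: "real_distribution \<kappa>"
      and eq: "\<And>x. isCont (cdf \<mu>) x \<Longrightarrow> isCont (cdf \<kappa>) x \<Longrightarrow> cdf \<mu> x = cdf \<kappa> x"
    for \<mu> \<kappa> :: "real measure" and x
  proof (rule dense_ge)
    interpret U: real_distribution \<mu> by fact
    interpret K: real_distribution \<kappa> by fact
    fix e assume "cdf \<kappa> x < e"
    then obtain s where s: "x < s" "cdf \<kappa> s < e"
      using K.measure_atMost_approx[of x e] by (auto simp: cdf_def)
    have "countable ({z. measure \<mu> {z} > 0} \<union> {z. measure \<kappa> {z} > 0})"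
      using U.countable_atoms K.countable_atoms by simp
    then have "{x<..<s} - ({z. measure \<mu> {z} > 0} \<union> {z. measure \<kappa> {z} > 0}) \<noteq> {}"
      using s uncountable_open_interval[of x s] by (metis countable_empty uncountable_minus_countable)
    then obtain z where z: "x < z" "z < s" "measure \<mu> {z} = 0" "measure \<kappa> {z} = 0"
      by (auto simp: zero_less_measure_iff)
    have "cdf \<mu> x \<le> cdf \<mu> z" using z by (intro U.cdf_nondecreasing) simp
    also have "\<dots> = cdf \<kappa> z" using z by (intro eq) (simp_all add: U.isCont_cdf K.isCont_cdf)
    also have "\<dots> \<le> cdf \<kappa> s" using z by (intro K.cdf_nondecreasing) simp
    finally show "cdf \<mu> x \<le> e" using s by simp
  qed
  have "cdf \<mu> = cdf \<kappa>"
    using le[OF \<mu> \<kappa> eq] le[OF \<kappa> \<mu> eq[symmetric]] by (intro ext antisym) auto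
  then show ?thesis using cdf_unique[OF \<mu> \<kappa>] by simp
qed

section \<open>Laws of processes and the Feller property\<close>

lemma process_on_measurable:
  assumes "process_on E M X" "x \<in> E" "0 \<le> t"
  shows "X x t \<in> borel_measurable (M x)"
  using assms by (auto simp: process_on_def measurable_restrict_space2_iff)

lemma process_on_space:
  assumes "process_on E M X" "x \<in> E" "0 \<le> t" "\<omega> \<in> space (M x)"
  shows "X x t \<omega> \<in> E"
  using assms measurable_space[of "X x t" "M x" "restrict_space borel E" \<omega>]
  by (auto simp: process_on_def space_restrict_space)

lemma process_on_law:
  assumes "process_on E M X" "x \<in> E" "0 \<le> t"
  shows "real_distribution (law M X t x)"
proof -
  interpret prob_space "M x" using assms by (auto simp: process_on_def)
  show ?thesis
    unfolding law_def by (rule real_distribution_distr[OF process_on_measurable[OF assms]])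
qed

lemma process_on_prob_le:
  assumes "process_on E M X" "x \<in> E" "0 \<le> t"
  shows "\<P>(\<omega> in M x. X x t \<omega> \<le> y) = measure (law M X t x) {..y}"
  unfolding law_def
  by (subst measure_distr[OF process_on_measurable[OF assms]]) (auto intro: arg_cong[where f="measure (M x)"])

lemma process_on_prob_ge:
  assumes "process_on E M X" "x \<in> E" "0 \<le> t"
  shows "\<P>(\<omega> in M x. y \<le> X x t \<omega>) = measure (law M X t x) {y..}"
  unfolding law_def
  by (subst measure_distr[OF process_on_measurable[OF assms]]) (auto intro: arg_cong[where f="measure (M x)"])

text \<open>Covers the levels \<open>y \<le> c\<close>, about which the duality relation for
  \<open>y > c\<close> says nothing.\<close>

lemma process_on_prob_ge_eq_1:
  assumes "process_on {c..} M X" "c \<le> x" "0 \<le> t" "y \<le> c"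
  shows "\<P>(\<omega> in M x. y \<le> X x t \<omega>) = 1"
proof -
  interpret prob_space "M x" using assms by (auto simp: process_on_def)
  have "{\<omega> \<in> space (M x). y \<le> X x t \<omega>} = space (M x)"
    using process_on_space[OF assms(1), of x t] assms by force
  then show ?thesis by (simp add: prob_space)
qed

text \<open>A ramp tends to 1 at minus infinity, but within \<open>{c..}\<close> infinity is reached
  only on the right, so it belongs to \<open>C_inf {c..}\<close>.\<close>

lemma feller_vaguely_continuous:
  assumes "feller_process {c..} N Y" "0 \<le> t"
  shows "vaguely_continuous {c..} (law N Y t)"
proof -
  have p: "process_on {c..} N Y"
    using assms by (auto simp: feller_process_def markov_process_def)
  have "continuous_on {c..} (\<lambda>x. LINT z|law N Y t x. ramp r s z)" if "r < s" for r s
  proof -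
    have "eventually (\<lambda>z. ramp r s z = 0) (inf at_infinity (principal {c..}))"
      unfolding eventually_inf_principal eventually_at_infinity
      \<comment> \<open>A point \<open>z \<ge> c\<close> with absolute value at least this bound
        cannot be negative, hence lies beyond \<open>s\<close>.\<close>
      using that by (intro exI[of _ "\<bar>c\<bar> + \<bar>s\<bar> + 1"]) (auto intro!: ramp_eq_0)
    then have "ramp r s \<in> C_inf {c..}"
      using that by (auto simp: C_inf_def continuous_on_ramp intro: tendsto_eventually)
    then have "continuous_on {c..} (semigroup_of N Y t (ramp r s))"
      using assms by (auto simp: feller_process_def C_inf_def)
    then show ?thesis
      by (rule continuous_on_eq)
         (simp add: semigroup_of_def law_def integral_distr process_on_measurable[OF p] assms)
  qed
  then show ?thesis
    using process_on_law[OF p] assms by (auto simp: vaguely_continuous_def)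
qed

lemma process_on_reflected:
  assumes "process_on UNIV M X"
  shows "process_on {0..} M (reflected X)"
proof -
  have "reflected X x t = (\<lambda>\<omega>. \<bar>X x t \<omega>\<bar>)" for x t
    by (auto simp: reflected_def)
  moreover have "AE \<omega> in M x. \<bar>X x 0 \<omega>\<bar> = x" if "0 \<le> x" for x
  proof -
    have "AE \<omega> in M x. X x 0 \<omega> = x"
      using assms by (auto simp: process_on_def)
    then show ?thesis by eventually_elim (use that in simp)
  qed
  ultimately show ?thesis
    using assms
    by (auto simp: process_on_def measurable_restrict_space2_iff intro!: borel_measurable_abs)
qed

text \<open>The Feller property is given for \<open>X\<close> on the whole line, so the ramp is
  composed with the absolute value. The result vanishes in both directions and is a test function in
  \<open>C_inf UNIV\<close>.\<close>

lemma feller_reflected_vaguely_continuous: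
  assumes "feller_process UNIV M X" "0 \<le> t"
  shows "vaguely_continuous {0..} (law M (reflected X) t)"
proof -
  have p: "process_on UNIV M X"
    using assms by (auto simp: feller_process_def markov_process_def)
  note p' = process_on_reflected[OF p]
  have "continuous_on {0..} (\<lambda>x. LINT z|law M (reflected X) t x. ramp r s z)" if "r < s" for r s
  proof -
    have "eventually (\<lambda>z. ramp r s \<bar>z\<bar> = 0) (at_infinity :: real filter)"
      unfolding eventually_at_infinity
      using that by (intro exI[of _ "\<bar>s\<bar>"]) (auto intro!: ramp_eq_0)
    moreover have "continuous_on UNIV (\<lambda>z. ramp r s \<bar>z\<bar>)"
      by (rule continuous_on_compose2[OF continuous_on_ramp[OF that, of UNIV]])
         (auto intro!: continuous_intros)
    ultimately have "(\<lambda>z. ramp r s \<bar>z\<bar>) \<in> C_inf UNIV"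
      by (auto simp: C_inf_def intro: tendsto_eventually)
    then have "continuous_on UNIV (semigroup_of M X t (\<lambda>z. ramp r s \<bar>z\<bar>))"
      using assms by (auto simp: feller_process_def C_inf_def)
    then have "continuous_on {0..} (semigroup_of M X t (\<lambda>z. ramp r s \<bar>z\<bar>))"
      by (rule continuous_on_subset) simp
    then show ?thesis
    proof (rule continuous_on_eq)
      fix x :: real assume "x \<in> {0..}"
      then show "semigroup_of M X t (\<lambda>z. ramp r s \<bar>z\<bar>) x = (LINT z|law M (reflected X) t x. ramp r s z)"
        unfolding law_def
        by (subst integral_distr[OF process_on_measurable[OF p']])
           (simp_all add: assms semigroup_of_def reflected_def)
    qed
  qed
  then show ?thesis
    using process_on_law[OF p'] assms by (auto simp: vaguely_continuous_def)
qed

section \<open>Existence and uniqueness of regularized duals\<close>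

text \<open>For fixed \<open>y > c\<close> duality turns the probability, as a function of
  \<open>x\<close>, into a distribution function, which is monotone and right continuous. The limit
  at \<open>c\<close> comes from vague continuity of the laws of \<open>W\<close>.\<close>

lemma regularized_dualI:
  assumes Z: "process_on {c..} M Z" and W: "process_on {c..} N W"
    and cont: "\<And>t. 0 \<le> t \<Longrightarrow> vaguely_continuous {c..} (law N W t)"
    and dual: "\<And>t x y. 0 \<le> t \<Longrightarrow> c \<le> x \<Longrightarrow> c < y \<Longrightarrow>
                 measure (law M Z t x) {y..} = measure (law N W t y) {..x}"
  shows "regularized_dual c M Z N W"
proof -
  have eq: "\<P>(\<omega> in M x. y \<le> Z x t \<omega>) = (if c < y then cdf (law N W t y) x else 1)"
    if "0 \<le> t" "c \<le> x" for x y t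
    using process_on_prob_ge[OF Z, of x t y] process_on_prob_ge_eq_1[OF Z, of x t y] that dual[of t x y]
    by (auto simp: cdf_def)
  have "stochastically_monotone c M Z"
    unfolding stochastically_monotone_def
  proof (intro allI impI mono_onI)
    fix t y r s :: real assume *: "0 \<le> t" "r \<in> {c..}" "s \<in> {c..}" "r \<le> s"
    show "\<P>(\<omega> in M r. y \<le> Z r t \<omega>) \<le> \<P>(\<omega> in M s. y \<le> Z s t \<omega>)"
    proof (cases "c < y")
      case True
      then interpret real_distribution "law N W t y"
        using process_on_law[OF W] * by auto
      show ?thesis using True * by (simp add: eq cdf_nondecreasing)
    qed (use * in \<open>simp add: eq\<close>)
  qed
  moreover have "continuous (at_right x) (\<lambda>x. \<P>(\<omega> in M x. y \<le> Z x t \<omega>))"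
    if *: "0 \<le> t" "c \<le> x" for t x y
  proof -
    have "continuous (at_right x) (\<lambda>x. if c < y then cdf (law N W t y) x else 1)"
    proof (cases "c < y")
      case True
      then interpret real_distribution "law N W t y"
        using process_on_law[OF W] * by auto
      show ?thesis using True cdf_is_right_cont by simp
    qed simp
    \<comment> \<open>The formula \<open>eq\<close> holds only for initial points in
      \<open>{c..}\<close>, which suffices to the right of \<open>x\<close>.\<close>
    moreover have "eventually (\<lambda>x'. (if c < y then cdf (law N W t y) x' else 1)
        = \<P>(\<omega> in M x'. y \<le> Z x' t \<omega>)) (at_right x)"
      using * by (auto simp: eq eventually_at_filter)
    ultimately show ?thesis
      unfolding continuous_within using * by (auto simp: eq dest: Lim_transform_eventually)
  qed
  moreover have "((\<lambda>y. \<P>(\<omega> in N y. W y t \<omega> \<le> x)) \<longlongrightarrow> \<P>(\<omega> in N c. W c t \<omega> \<le> x)) (at_right c)"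
    if *: "0 \<le> t" "isCont (cdf (law N W t c)) x" for t x
  proof -
    have "((\<lambda>y. measure (law N W t y) {..x}) \<longlongrightarrow> measure (law N W t c) {..x}) (at_right c)"
      using vaguely_continuous_cdf_tendsto[OF cont, of t c x] *
      by (auto intro: tendsto_within_subset)
    moreover have "eventually (\<lambda>y. measure (law N W t y) {..x} = \<P>(\<omega> in N y. W y t \<omega> \<le> x)) (at_right c)"
      using * by (auto simp: eventually_at_filter process_on_prob_le[OF W])
    ultimately show ?thesis
      using * by (auto simp: process_on_prob_le[OF W, of c] dest: Lim_transform_eventually)
  qed
  ultimately show ?thesis
    using Z W dual by (auto simp: regularized_dual_def process_on_prob_le[OF W] process_on_prob_ge[OF Z])
qed

text \<open>For initial points above \<open>c\<close> duality prescribes the distribution function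
  on \<open>{c..}\<close>, and it vanishes below \<open>c\<close>. At \<open>c\<close> both laws are
  limits of the same distribution functions.\<close>

lemma regularized_dual_law_unique:
  assumes W: "regularized_dual c M Z N W" and W': "regularized_dual c M' Z' N' W'"
    and Z: "\<And>x. c \<le> x \<Longrightarrow> law M Z t x = law M' Z' t x" and t: "0 \<le> t" and y: "c \<le> y"
  shows "law N W t y = law N' W' t y"
proof -
  have p: "process_on {c..} M Z" "process_on {c..} N W"
      "process_on {c..} M' Z'" "process_on {c..} N' W'"
    using W W' by (auto simp: regularized_dual_def)
  note dist = process_on_law[OF p(2) _ t] process_on_law[OF p(4) _ t]
  have prob: "\<P>(\<omega> in N y. W y t \<omega> \<le> x) = \<P>(\<omega> in N' y. W' y t \<omega> \<le> x)" if "c < y" for x y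
  proof (cases "c \<le> x")
    case True
    then have "\<P>(\<omega> in M x. y \<le> Z x t \<omega>) = \<P>(\<omega> in M' x. y \<le> Z' x t \<omega>)"
      using Z[of x] t by (simp add: process_on_prob_ge[OF p(1)] process_on_prob_ge[OF p(3)])
    then show ?thesis
      using W W' t True that by (auto simp: regularized_dual_def)
  next
    case False
    \<comment> \<open>Both processes take values in \<open>{c..}\<close>.\<close>
    then have "{\<omega> \<in> space (N y). W y t \<omega> \<le> x} = {}" "{\<omega> \<in> space (N' y). W' y t \<omega> \<le> x} = {}"
      using process_on_space[OF p(2), of y t] process_on_space[OF p(4), of y t] that t by force+
    then show ?thesis by (simp only:) simp
  qed
  have cdf_eq: "cdf (law N W t y) x = \<P>(\<omega> in N y. W y t \<omega> \<le> x)"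
     "cdf (law N' W' t y) x = \<P>(\<omega> in N' y. W' y t \<omega> \<le> x)" if "c \<le> y" for x y
    using that t by (simp_all add: cdf_def process_on_prob_le[OF p(2)] process_on_prob_le[OF p(4)])
  show ?thesis
  proof (rule cdf_eq_if_eq_at_continuity_points)
    show "real_distribution (law N W t y)" "real_distribution (law N' W' t y)"
      using dist y by auto
    fix x assume x: "isCont (cdf (law N W t y)) x" "isCont (cdf (law N' W' t y)) x"
    show "cdf (law N W t y) x = cdf (law N' W' t y) x"
    proof (cases "c < y")
      case True
      then show ?thesis by (simp add: cdf_eq prob)
    next
      case False
      then have c: "y = c" using y by simp
      \<comment> \<open>Both limits are available at the same \<open>x\<close>, since it is a
        continuity point of both laws.\<close>
      have lim: "((\<lambda>y. \<P>(\<omega> in N y. W y t \<omega> \<le> x)) \<longlongrightarrow> \<P>(\<omega> in N c. W c t \<omega> \<le> x)) (at_right c)"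
        and lim': "((\<lambda>y. \<P>(\<omega> in N' y. W' y t \<omega> \<le> x)) \<longlongrightarrow> \<P>(\<omega> in N' c. W' c t \<omega> \<le> x)) (at_right c)"
        using W W' t x unfolding c regularized_dual_def by presburger+
      have "eventually (\<lambda>y. \<P>(\<omega> in N y. W y t \<omega> \<le> x) = \<P>(\<omega> in N' y. W' y t \<omega> \<le> x)) (at_right c)"
        by (auto simp: eventually_at_filter prob)
      with lim have "((\<lambda>y. \<P>(\<omega> in N' y. W' y t \<omega> \<le> x)) \<longlongrightarrow> \<P>(\<omega> in N c. W c t \<omega> \<le> x)) (at_right c)"
        by (rule Lim_transform_eventually)
      with lim' show ?thesis
        using tendsto_unique[OF trivial_limit_at_right_real] by (simp add: c cdf_eq)
    qed
  qed
qed

text \<open>Duality constrains one-dimensional laws only, so coincidence of the second regularized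
  dual with the reflected process is equality of these laws. The first two conjuncts exhibit a chain
  to which the third applies.\<close>

theorem proposition4p2:
  fixes M :: "real \<Rightarrow> 'w measure" and X :: "real \<Rightarrow> real \<Rightarrow> 'w \<Rightarrow> real"
    and N :: "real \<Rightarrow> 'v measure" and Y :: "real \<Rightarrow> real \<Rightarrow> 'v \<Rightarrow> real"
    and a b :: "real \<Rightarrow> real" and \<nu> :: "real \<Rightarrow> real measure"
  assumes "feller_process UNIV M X"
    and "generated_by M X (levy_operator a b \<nu>)"
    and "a \<in> C2" and "b \<in> C2" and "\<And>x. 0 \<le> a x"
    and "levy_kernel \<nu>" and "weakly_continuous_kernel \<nu>"
    and "\<And>y. ((\<lambda>z. measure (\<nu> z) {y..}) \<longlongrightarrow> 0) at_bot"
    and "\<And>y. ((\<lambda>z. measure (\<nu> z) {..<y}) \<longlongrightarrow> 0) at_top"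
    and "\<And>y. mono_on {..<y} (\<lambda>z. measure (\<nu> z) {y..})"
    and "\<And>y. mono_on {y<..} (\<lambda>z. - measure (\<nu> z) {..<y})"
    and "levy_kernel (dual_kernel \<nu>)"
    and "\<And>y. pv_integral_exists \<nu> (dual_kernel \<nu>) y"
    and "\<And>x. a (- x) = a x" and "\<And>x. b (- x) = - b x"
    and "\<And>x. 0 \<le> x \<Longrightarrow> emeasure (\<nu> x) {..<0} = 0"
    and "\<And>x. \<nu> (- x) = distr (\<nu> x) borel uminus"
    and "finite_measure (\<nu> 0)"
    and "feller_process {0..} N Y"
    and "dual_on {0..} M (reflected X) N Y"
  shows "regularized_dual 0 N Y M (reflected X)
    \<and> regularized_dual 0 M (reflected X) N Y
    \<and> (\<forall>(N' :: real \<Rightarrow> 'p measure) Y' (M' :: real \<Rightarrow> 'q measure) W.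
         regularized_dual 0 M (reflected X) N' Y' \<and> regularized_dual 0 N' Y' M' W
         \<longrightarrow> (\<forall>t\<ge>0. \<forall>x\<ge>0. law M' W t x = law M (reflected X) t x))"
proof -
  have X: "process_on {0..} M (reflected X)" and Y: "process_on {0..} N Y"
    using assms(1,19) by (auto simp: feller_process_def markov_process_def process_on_reflected)
  note cont = feller_reflected_vaguely_continuous[OF assms(1)] feller_vaguely_continuous[OF assms(19)]
  have dual: "measure (law M (reflected X) t x) {y..} = measure (law N Y t y) {..x}"
    if "0 \<le> t" "0 \<le> x" "0 \<le> y" for t x y
    using assms(20) that unfolding dual_on_def
    by (simp add: process_on_prob_le[OF Y] process_on_prob_ge[OF X])
  \<comment> \<open>The dual is itself a regularized dual: its law at 0 is the required limit by its
    Feller property.\<close>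
  have first: "regularized_dual 0 M (reflected X) N Y"
    by (rule regularized_dualI[OF X Y cont(2)]) (simp_all add: dual)
  have second: "regularized_dual 0 N Y M (reflected X)"
    by (rule regularized_dualI[OF Y X cont(1)]) (simp_all add: dual_laws_swap[OF cont dual])
  have "law M' W t x = law M (reflected X) t x"
    if "regularized_dual 0 M (reflected X) N' Y'" "regularized_dual 0 N' Y' M' W" "0 \<le> t" "0 \<le> x"
    for N' :: "real \<Rightarrow> 'p measure" and Y' and M' :: "real \<Rightarrow> 'q measure" and W t x
  \<comment> \<open>Uniqueness is used twice: here for the second dual, and inside for the first,
    whose laws agree with those of \<open>Y\<close>.\<close>
  proof (rule regularized_dual_law_unique[OF that(2) second _ that(3,4)])
    show "law N' Y' t z = law N Y t z" if "0 \<le> z" for z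
      using that by (rule regularized_dual_law_unique[OF \<open>regularized_dual 0 M (reflected X) N' Y'\<close> first refl \<open>0 \<le> t\<close>])
  qed
  with first second show ?thesis by blast
qed

end
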